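(* For any primitive set $A\subset\mathbb{Z}_{>1}$ we have $f(A)\le f(\mathcal P)$, where $f(A)=\sum_{a\in A}\frac{1}{a\log a}$ and $\mathcal P$ is the set of prime numbers.
   Context: A set $A\subset\mathbb{Z}_{>1}$ is primitive if no member of $A$ divides another member of $A$. For a set $A\subset\mathbb{Z}_{>1}$, $f(A)=\sum_{a\in A}\frac{1}{a\log a}$. *)

theory Defs
  imports "HOL-Analysis.Analysis" "HOL-Computational_Algebra.Primes"
begin

definition primitive :: "nat set \<Rightarrow> bool" where
  "primitive A \<longleftrightarrow> A \<subseteq> {2..} \<and> (\<forall>a\<in>A. \<forall>b\<in>A. a dvd b \<longrightarrow> a = b)"

definition erdos_f :: "nat set \<Rightarrow> ennreal" where
  "erdos_f A = (\<Sum>\<^sub>\<infinity>a\<in>A. ennreal (1 / (real a * ln (real a))))"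

end

theory Submission
  imports Defs "HOL-Number_Theory.Prime_Powers"
begin

text \<open>
  Give \<open>n\<close> the weight \<open>w n = 1 / (n * ln n)\<close> and move mass from \<open>m\<close> to its proper divisors,
  the divisor \<open>m / q\<close> receiving the fraction \<open>\<Lambda> q / ln m\<close>; the share of a prime power that would
  reach 1 goes to the underlying prime. All mass ends up on primes. The weight \<open>w\<close> is
  superharmonic for this flow: the inflow \<open>1/n * (\<Sum>q. \<Lambda> q / (q * (ln (n * q))\<^sup>2))\<close> is at most \<open>w n\<close> by partial
  summation from \<open>(\<Sum>d\<le>x. \<Lambda> d / d) \<le> ln x\<close>, and as the latter sum vanishes for \<open>x < 2\<close> there is a gain of
  \<open>w n * (ln 2 / ln (2 * n))\<^sup>2\<close>, which at a prime \<open>n\<close> pays for the redirected mass.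
  Start with mass \<open>w a\<close> at every member \<open>a\<close> of a finite primitive set. A point that carries mass and
  lies in the set receives nothing from above, so the mass passing through any \<open>n\<close> never exceeds \<open>w n\<close>,
  and the conserved total is at most the sum of \<open>w\<close> over primes.

  The bound \<open>(\<Sum>d\<le>N. \<Lambda> d / d) \<le> ln N\<close> follows for \<open>N \<ge> 46\<close> from Legendre's formula
  for \<open>ln (fact N)\<close> and \<open>(\<Sum>d\<le>x. \<Lambda> d) \<le> (x - 1) * ln 4\<close>; the remaining cases are numerical.
\<close>

subsection \<open>Partial summation\<close>

text \<open>Abel summation by induction: the partial sum up to N is nonnegative, so lowering its
  factor from \<open>g N\<close> to \<open>g (Suc N)\<close> only decreases the left side.\<close>

lemma sum_mult_antimono_ge:
  fixes c g :: "nat \<Rightarrow> real"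
  assumes "\<And>n. n \<le> N \<Longrightarrow> 0 \<le> (\<Sum>d=1..n. c d)"
    and "\<And>n. 1 \<le> n \<Longrightarrow> n < N \<Longrightarrow> g (Suc n) \<le> g n"
  shows "g N * (\<Sum>d=1..N. c d) \<le> (\<Sum>d=1..N. c d * g d)"
  using assms
proof (induction N)
  case (Suc N)
  have IH: "g N * (\<Sum>d=1..N. c d) \<le> (\<Sum>d=1..N. c d * g d)"
    using Suc by simp
  have "g (Suc N) * (\<Sum>d=1..N. c d) \<le> g N * (\<Sum>d=1..N. c d)"
  proof (cases "N = 0")
    case False
    then show ?thesis
      using Suc.prems(1)[of N] Suc.prems(2)[of N] by (intro mult_right_mono) auto
  qed simp
  with IH show ?case
    by (simp add: algebra_simps)
qed simp

text \<open>Lets \<open>mangoldt\<close> be replaced, under a decreasing weight, by an explicit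
  sequence whose partial sums dominate.\<close>

lemma sum_mult_antimono_mono:
  fixes a b g :: "nat \<Rightarrow> real"
  assumes "\<And>n. n \<le> N \<Longrightarrow> (\<Sum>d=1..n. a d) \<le> (\<Sum>d=1..n. b d)"
    and "\<And>n. 1 \<le> n \<Longrightarrow> n < N \<Longrightarrow> g (Suc n) \<le> g n"
    and "0 \<le> g N"
  shows "(\<Sum>d=1..N. a d * g d) \<le> (\<Sum>d=1..N. b d * g d)"
proof -
  have "0 \<le> g N * (\<Sum>d=1..N. b d - a d)"
    using assms(1)[of N] assms(3) by (simp add: sum_subtractf)
  also have "\<dots> \<le> (\<Sum>d=1..N. (b d - a d) * g d)"
    using assms by (intro sum_mult_antimono_ge) (auto simp: sum_subtractf)
  finally show ?thesis
    by (simp add: algebra_simps sum_subtractf)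
qed

subsection \<open>Chebyshev and Mertens bounds\<close>

text \<open>Legendre's formula. From n to n + 1 the quotient by d grows by one exactly when d
  divides n + 1, and \<open>mangoldt\<close> sums to ln (n + 1) over these d. The separate bound N
  lets several factorials share one range of summation.\<close>

lemma sum_mangoldt_mult_div:
  assumes "n \<le> N"
  shows "(\<Sum>d=1..N. mangoldt d * real (n div d)) = ln (fact n)"
  using assms
proof (induction n)
  case (Suc n)
  have "(\<Sum>d=1..N. mangoldt d * real (Suc n div d))
      = (\<Sum>d=1..N. mangoldt d * real (n div d) + (if d dvd Suc n then mangoldt d else 0))"
    by (intro sum.cong) (auto simp: div_Suc algebra_simps dvd_eq_mod_eq_0)
  also have "\<dots> = ln (fact n) + (\<Sum>d=1..N. if d dvd Suc n then mangoldt d else 0)"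
    using Suc by (simp add: sum.distrib)
  also have "(\<Sum>d=1..N. if d dvd Suc n then mangoldt d else (0::real))
      = (\<Sum>d | d dvd Suc n. mangoldt d)"
  proof (intro sum.mono_neutral_cong_right subsetI)
    fix d assume "d \<in> {d. d dvd Suc n}"
    then show "d \<in> {1..N}"
      using Suc.prems dvd_imp_le[of d "Suc n"] by (cases d) auto
  qed auto
  also have "\<dots> = ln (real (Suc n))"
    using mangoldt_sum[of "Suc n", where 'a = real] by simp
  also have "ln (fact n) + ln (real (Suc n)) = ln (fact (Suc n))"
    by (subst ln_mult_pos [symmetric]) (auto simp: algebra_simps)
  finally show ?case .
qed simp

text \<open>By Legendre's formula the logarithm of the binomial coefficient is the sum of
  \<open>mangoldt d * ?e d\<close>. Here \<open>?e\<close> is nonnegative, and it is 1 for m < d <=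
  m + k, since then k <= m < d and m + k < 2 * d.\<close>

lemma sum_mangoldt_diff_le_ln_binomial:
  assumes "k \<le> m" "m \<le> Suc k"
  shows "(\<Sum>d=Suc m..m+k. mangoldt d) \<le> ln (real ((m + k) choose m))"
proof -
  let ?e = "\<lambda>d. real ((m + k) div d) - real (m div d) - real (k div d)"
  have nonneg: "0 \<le> ?e d" for d
  proof -
    have "m div d + k div d \<le> (m + k) div d"
      using div_add1_eq[of m k d] by simp
    then show ?thesis
      by linarith
  qed
  have "(\<Sum>d=Suc m..m+k. mangoldt d) \<le> (\<Sum>d=Suc m..m+k. mangoldt d * ?e d)"
  proof (intro sum_mono)
    fix d assume "d \<in> {Suc m..m+k}"
    then have d: "m < d" "d \<le> m + k"
      by auto
    then have "(m + k) div d = 1"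
      using assms by (intro div_nat_eqI) auto
    then show "mangoldt d \<le> (mangoldt d * ?e d :: real)"
      using d assms by simp
  qed
  also have "\<dots> \<le> (\<Sum>d=1..m+k. mangoldt d * ?e d)"
    using nonneg by (intro sum_mono2 mult_nonneg_nonneg mangoldt_nonneg) auto
  also have "\<dots> = ln (fact (m + k)) - ln (fact m) - ln (fact k)"
    using sum_mangoldt_mult_div[of "m + k" "m + k"] sum_mangoldt_mult_div[of m "m + k"]
      sum_mangoldt_mult_div[of k "m + k"]
    by (simp add: right_diff_distrib sum_subtractf)
  also have "\<dots> = ln (real ((m + k) choose m))"
    by (simp add: binomial_fact ln_div ln_mult_pos)
  finally show ?thesis .
qed

text \<open>In an odd row the two central coefficients are equal and together at most 2 * 4 ^
  k.\<close>

lemma binomial_near_centre_le: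
  assumes "k \<le> m" "m \<le> Suc k"
  shows "(m + k) choose m \<le> 4 ^ k"
proof (cases "m = k")
  case True
  then show ?thesis
    using binomial_le_pow2[of "2 * k" k] by (simp add: power_mult flip: mult_2)
next
  case False
  then have m: "m = Suc k"
    using assms by simp
  have "((2 * k + 1) choose k) + ((2 * k + 1) choose Suc k) \<le> (\<Sum>i\<le>2*k+1. (2*k+1) choose i)"
    by (rule order_trans[OF _ sum_mono2[of "{..2*k+1}" "{k, Suc k}"]]) auto
  also have "\<dots> = 2 * 4 ^ k"
    by (subst choose_row_sum) (simp add: power_mult)
  finally show ?thesis
    using binomial_symmetric[of k "2 * k + 1"] m by (simp add: mult_2)
qed

text \<open>Chebyshev's bound by halving: the block from m + 1 to n = m + k costs at most k * ln 4.
  The -1 stems from n = 1, where the sum vanishes, and survives into the Mertens estimate.\<close>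

lemma sum_mangoldt_le:
  assumes "n \<ge> 1"
  shows "(\<Sum>d=1..n. mangoldt d) \<le> (real n - 1) * ln 4"
  using assms
proof (induction n rule: less_induct)
  case (less n)
  show ?case
  proof (cases "n = 1")
    case False
    define k where "k = n div 2"
    define m where "m = n - k"
    have km: "k \<le> m" "m \<le> Suc k" "m + k = n" "1 \<le> m" "m < n"
      using False less.prems by (auto simp: k_def m_def)
    have "(\<Sum>d=1..n. mangoldt d) = (\<Sum>d=1..m. mangoldt d) + (\<Sum>d=Suc m..m+k. mangoldt d :: real)"
      using sum.ub_add_nat[of 1 m mangoldt k] km by simp
    also have "\<dots> \<le> (real m - 1) * ln 4 + ln (real ((m + k) choose m))"
      using less.IH[of m] km by (intro add_mono sum_mangoldt_diff_le_ln_binomial) auto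
    also have "ln (real ((m + k) choose m)) \<le> ln (4 ^ k)"
    proof -
      have "real ((m + k) choose m) \<le> real (4 ^ k)"
        using binomial_near_centre_le[OF km(1,2)] by (simp only: of_nat_le_iff)
      moreover have "0 < (m + k) choose m"
        by simp
      ultimately show ?thesis
        by (subst ln_le_cancel_iff) auto
    qed
    also have "(real m - 1) * ln 4 + ln (4 ^ k) = (real n - 1) * ln 4"
      using km(3) by (simp add: ln_realpow algebra_simps flip: km(3))
    finally show ?thesis by simp
  qed simp
qed

text \<open>The induction step amounts to ln (n + 1) - ln n >= 1 / (n + 1/2), the midpoint bound for
  the integral of the convex function 1 / x. The constant 1 gives equality at n = 1.\<close>

lemma ln_fact_le_Stirling:
  assumes "n \<ge> 1"
  shows "ln (fact n) \<le> (real n + 1/2) * ln (real n) - real n + 1"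
  using assms
proof (induction n rule: nat_induct_at_least)
  case (Suc n)
  have "1 \<le> (real n + 1/2) * (ln (real (Suc n)) - ln (real n))"
    using ln_inverse_approx_ge[of "real n" "real (Suc n)"] Suc.hyps by (simp add: field_simps)
  moreover have "ln (fact (Suc n)) = ln (real (Suc n)) + ln (fact n)"
    by (simp add: ln_mult_pos del: of_nat_Suc)
  ultimately show ?case
    using Suc.IH by (simp add: algebra_simps)
qed simp

lemma sum_inverse_le_ln:
  assumes "1 \<le> m" "m \<le> n"
  shows "(\<Sum>d=Suc m..n. 1 / real d) \<le> ln (real n / real m)"
  using assms(2)
proof (induction n rule: dec_induct)
  case (step n)
  have "ln (real n / real (Suc n)) \<le> real n / real (Suc n) - 1"
    using step.hyps assms(1) by (intro ln_le_minus_one) auto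
  then have "1 / real (Suc n) \<le> ln (real (Suc n)) - ln (real n)"
    using step.hyps assms(1) by (simp add: ln_div field_simps)
  then show ?case
    using step assms(1) by (simp add: ln_div del: of_nat_Suc)
qed (use assms in simp)

text \<open>The minimum is 1 up to N / 2 and N / d - 1 beyond; the corresponding integral is N *
  (1/2 + ln 2 - 1/2).\<close>

lemma sum_min_le_ln2:
  assumes "N \<ge> 2"
  shows "(\<Sum>d=1..N. min 1 (real N / real d - 1)) \<le> real N * ln 2"
proof -
  define n where "n = N div 2"
  have n: "1 \<le> n" "2 * n \<le> N" "N \<le> 2 * n + 1"
    using assms by (auto simp: n_def)
  have "(\<Sum>d=1..N. min 1 (real N / real d - 1)) \<le>
      (\<Sum>d=1..n. 1) + (\<Sum>d=Suc n..N. real N / real d - 1)"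
  proof -
    have "(\<Sum>d=1..N. min 1 (real N / real d - 1)) = (\<Sum>d=1..n. min 1 (real N / real d - 1))
        + (\<Sum>d=Suc n..N. min 1 (real N / real d - 1))"
      using sum.ub_add_nat[of 1 n "\<lambda>d. min 1 (real N / real d - 1)" "N - n"] n by simp
    also have "\<dots> \<le> (\<Sum>d=1..n. 1) + (\<Sum>d=Suc n..N. real N / real d - 1)"
      by (intro add_mono sum_mono) auto
    finally show ?thesis .
  qed
  also have "\<dots> = real n - real (N - n) + real N * (\<Sum>d=Suc n..N. 1 / real d)"
    by (simp add: sum_subtractf sum_distrib_left)
  also have "\<dots> \<le> real N * ln 2"
  proof (cases "N = 2 * n")
    case True
    then have "real N * (\<Sum>d=Suc n..N. 1 / real d) \<le> real N * ln 2"
      using sum_inverse_le_ln[of n N] n by (intro mult_left_mono) auto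
    then show ?thesis
      using True by simp
  next
    case False
    with n have N: "N = 2 * n + 1"
      by simp
    \<comment> \<open>A logarithmic comparison starting at n would give N / n > 2. With the first
      term split off the excess is N / (2 * (n + 1)) < 1, which n - (N - n) = -1 pays for.\<close>
    have "(\<Sum>d=Suc n..N. 1 / real d) = 1 / real (Suc n) + (\<Sum>d=Suc (Suc n)..N. 1 / real d)"
      using n by (intro sum.atLeast_Suc_atMost) simp
    also have "\<dots> \<le> 1 / real (Suc n) + ln (real N / real (Suc n))"
      using N sum_inverse_le_ln[of "Suc n" N] n by simp
    also have "real N / real (Suc n) = 2 * (1 - 1 / (2 * real (Suc n)))"
      by (simp add: N field_simps)
    also have "ln \<dots> = ln 2 + ln (1 - 1 / (2 * real (Suc n)))"
      by (intro ln_mult_pos) auto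
    also have "ln (1 - 1 / (2 * real (Suc n))) \<le> - 1 / (2 * real (Suc n))"
      using ln_le_minus_one[of "1 - 1 / (2 * real (Suc n))"] by simp
    also have "1 / real (Suc n) + (ln 2 + - 1 / (2 * real (Suc n))) = ln 2 + 1 / (2 * real (Suc n))"
      using mult_divide_mult_cancel_left[of 2 1 "real (Suc n)"] by simp
    finally have "(\<Sum>d=Suc n..N. 1 / real d) \<le> ln 2 + 1 / (2 * real (Suc n))"
      by simp
    then have "real N * (\<Sum>d=Suc n..N. 1 / real d) \<le> real N * (ln 2 + 1 / (2 * real (Suc n)))"
      by (intro mult_left_mono) auto
    also have "\<dots> \<le> real N * ln 2 + 1"
      by (simp add: N field_simps)
    finally show ?thesis
      using N by simp
  qed
  finally show ?thesis .
qed

section \<open>Explicit upper bound in Mertens' first theorem\<close>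

definition mangoldt_harm :: "nat \<Rightarrow> real" where
  "mangoldt_harm n = (\<Sum>d=1..n. mangoldt d / real d)"

text \<open>Split N / d into integer and fractional part. The integer parts give ln (fact N) by
  Legendre; the fractional parts are handled by Chebyshev's bound and partial summation.\<close>

lemma mult_mangoldt_harm_le:
  assumes "N \<ge> 2"
  shows "real N * mangoldt_harm N \<le> ln (fact N) + ln 4 * (real N * ln 2 - 1)"
proof -
  \<comment> \<open>\<open>g d\<close> bounds the fractional part of \<open>N / d\<close> and, unlike it, is nonincreasing in \<open>d\<close>.\<close>
  define g where "g = (\<lambda>d. min 1 (real N / real d - 1))"
  have antimono: "g (Suc d) \<le> g d" if "1 \<le> d" for d
  proof -
    have "real N / real (Suc d) \<le> real N / real d"
      using that by (intro divide_left_mono) auto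
    then show ?thesis
      by (auto simp: g_def)
  qed
  have frac: "real N / real d \<le> real (N div d) + g d" if "d \<in> {1..N}" for d
  proof -
    have "real N = real (N div d) * real d + real (N mod d)"
      by (metis div_mult_mod_eq of_nat_add of_nat_mult)
    moreover have "N mod d < d"
      using that by simp
    ultimately have "real N / real d \<le> real (N div d) + 1"
      using that by (simp add: divide_le_eq algebra_simps)
    moreover have "1 \<le> N div d"
      using that by (simp add: div_greater_zero_iff Suc_le_eq)
    ultimately show ?thesis
      by (auto simp: g_def)
  qed
  \<comment> \<open>The partial sums of \<open>b\<close> are the Chebyshev bounds (n - 1) * ln 4.
    Its zero at 1 removes the term \<open>g 1 = 1\<close>, which produces the -1 in the
    estimate.\<close>
  define b :: "nat \<Rightarrow> real" where "b = (\<lambda>d. if d = 1 then 0 else ln 4)"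
  have "(\<Sum>d=1..N. mangoldt d * g d) \<le> (\<Sum>d=1..N. b d * g d)"
  proof (rule sum_mult_antimono_mono)
    fix n
    have "(\<Sum>d=1..n. b d) = (real n - 1) * ln 4" if "1 \<le> n"
      using that by (induction n rule: nat_induct_at_least) (auto simp: b_def algebra_simps)
    then show "(\<Sum>d=1..n. mangoldt d) \<le> (\<Sum>d=1..n. b d)"
      using sum_mangoldt_le[of n] by (cases "n = 0") auto
  qed (use antimono assms in \<open>auto simp: g_def\<close>)
  also have "\<dots> = ln 4 * ((\<Sum>d=1..N. g d) - 1)"
  proof -
    have "(\<Sum>d=1..N. b d * g d) = (\<Sum>d\<in>{1..N} - {1}. ln 4 * g d)"
      by (intro sum.mono_neutral_cong_right) (auto simp: b_def)
    also have "\<dots> = ln 4 * ((\<Sum>d=1..N. g d) - g 1)"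
      using assms by (subst sum_diff1) (auto simp: sum_distrib_left algebra_simps)
    also have "g 1 = 1"
      using assms by (simp add: g_def)
    finally show ?thesis .
  qed
  also have "\<dots> \<le> ln 4 * (real N * ln 2 - 1)"
    using sum_min_le_ln2[OF assms] by (intro mult_left_mono diff_right_mono) (auto simp: g_def)
  finally have "(\<Sum>d=1..N. mangoldt d * g d) \<le> ln 4 * (real N * ln 2 - 1)" .
  moreover have "real N * mangoldt_harm N \<le> (\<Sum>d=1..N. mangoldt d * (real (N div d) + g d))"
    unfolding mangoldt_harm_def sum_distrib_left
  proof (rule sum_mono)
    fix d assume "d \<in> {1..N}"
    then have "mangoldt d * (real N / real d) \<le> mangoldt d * (real (N div d) + g d)"
      by (intro mult_left_mono frac mangoldt_nonneg)
    then show "real N * (mangoldt d / real d) \<le> mangoldt d * (real (N div d) + g d)"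
      by (simp add: mult.commute)
  qed
  moreover have "(\<Sum>d=1..N. mangoldt d * (real (N div d) + g d))
      = ln (fact N) + (\<Sum>d=1..N. mangoldt d * g d)"
    using sum_mangoldt_mult_div[of N N] by (simp add: algebra_simps sum.distrib)
  ultimately show ?thesis
    by simp
qed

lemma ln_4_eq: "ln 4 = 2 * ln (2::real)"
  using ln_realpow[of 2 2] by simp

text \<open>Works because 2 * (ln 2)^2 < 1: the error terms linear in N have a negative total
  coefficient, which beats ln N / 2 and the constants.\<close>

lemma mangoldt_harm_le_ln_large:
  assumes "N \<ge> 46"
  shows "mangoldt_harm N \<le> ln (real N)"
proof -
  have l: "2/3 \<le> ln (2::real)" "ln (2::real) \<le> 25/36"
    by (fact ln2_ge_two_thirds, fact ln2_le_25_over_36)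
  have sq: "ln 2 * ln (2::real) \<le> 25/36 * (25/36)"
    using l by (intro mult_mono) auto
  \<comment> \<open>Tangent of \<open>ln\<close> at 64 = 2 ^ 6. With it the error is at most about
    1.25 - 0.0277 * N, negative from N = 46 on.\<close>
  have "ln (real N / 64) \<le> real N / 64 - 1"
    using assms by (intro ln_le_minus_one) auto
  moreover have "ln (64::real) = 6 * ln 2"
    using ln_realpow[of 2 6] by simp
  ultimately have lnN: "ln (real N) \<le> 6 * (25/36) + real N / 64 - 1"
    using assms l by (simp add: ln_div)
  have "real N * mangoldt_harm N \<le> ln (fact N) + ln 4 * (real N * ln 2 - 1)"
    using assms by (intro mult_mangoldt_harm_le) auto
  also have "\<dots> \<le> (real N + 1/2) * ln (real N) - real N + 1 + ln 4 * (real N * ln 2 - 1)"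
    using assms by (intro add_right_mono ln_fact_le_Stirling) auto
  also have "\<dots> = real N * ln (real N) + (ln (real N) / 2 - real N + 1
      + 2 * (real N * (ln 2 * ln 2)) - 2 * ln 2)"
    by (simp add: ln_4_eq algebra_simps)
  also have "real N * (ln 2 * ln (2::real)) \<le> real N * (25/36 * (25/36))"
    using sq by (intro mult_left_mono) auto
  also have "ln (real N) / 2 - real N + 1 + 2 * (real N * (25/36 * (25/36))) - 2 * ln 2 \<le> 0"
    using lnN l assms by simp
  finally show ?thesis
    using assms by simp
qed

section \<open>Numerical verification of the Mertens bound up to 46\<close>

lemma mangoldt_eq_0:
  assumes "prime p" "prime q" "p \<noteq> q" "p dvd n" "q dvd n"
  shows "mangoldt n = 0"
proof -
  have False if "primepow n"
  proof -
    from that obtain r k where "prime r" "n = r ^ k"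
      by (auto simp: primepow_def)
    with assms show False
      by (metis prime_dvd_power primes_dvd_imp_eq)
  qed
  then show ?thesis
    by (auto simp: mangoldt_def)
qed

lemma mangoldt_small_primepow:
  shows "mangoldt 4 = (ln 2 :: real)"
    and "mangoldt 8 = (ln 2 :: real)"
    and "mangoldt 9 = (ln 3 :: real)"
    and "mangoldt 16 = (ln 2 :: real)"
    and "mangoldt 25 = (ln 5 :: real)"
    and "mangoldt 27 = (ln 3 :: real)"
    and "mangoldt 32 = (ln 2 :: real)"
  using mangoldt_primepow'[of 2 2, where 'a = real] mangoldt_primepow'[of 2 3, where 'a = real] mangoldt_primepow'[of 3 2, where 'a = real] mangoldt_primepow'[of 2 4, where 'a = real] mangoldt_primepow'[of 5 2, where 'a = real] mangoldt_primepow'[of 3 3, where 'a = real] mangoldt_primepow'[of 2 5, where 'a = real]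
  by simp_all

lemma mangoldt_small_eq_0:
  shows "mangoldt 6 = (0 :: real)"
    and "mangoldt 10 = (0 :: real)"
    and "mangoldt 12 = (0 :: real)"
    and "mangoldt 14 = (0 :: real)"
    and "mangoldt 15 = (0 :: real)"
    and "mangoldt 18 = (0 :: real)"
    and "mangoldt 20 = (0 :: real)"
    and "mangoldt 21 = (0 :: real)"
    and "mangoldt 22 = (0 :: real)"
    and "mangoldt 24 = (0 :: real)"
    and "mangoldt 26 = (0 :: real)"
    and "mangoldt 28 = (0 :: real)"
    and "mangoldt 30 = (0 :: real)"
    and "mangoldt 33 = (0 :: real)"
    and "mangoldt 34 = (0 :: real)"
    and "mangoldt 35 = (0 :: real)"
    and "mangoldt 36 = (0 :: real)"
    and "mangoldt 38 = (0 :: real)"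
    and "mangoldt 39 = (0 :: real)"
    and "mangoldt 40 = (0 :: real)"
    and "mangoldt 42 = (0 :: real)"
    and "mangoldt 44 = (0 :: real)"
    and "mangoldt 45 = (0 :: real)"
    and "mangoldt 46 = (0 :: real)"
  by (simp_all add: mangoldt_eq_0[of 2 3] mangoldt_eq_0[of 2 5] mangoldt_eq_0[of 2 7]
      mangoldt_eq_0[of 2 11] mangoldt_eq_0[of 2 13] mangoldt_eq_0[of 2 17] mangoldt_eq_0[of 2 19]
      mangoldt_eq_0[of 2 23] mangoldt_eq_0[of 3 5] mangoldt_eq_0[of 3 7] mangoldt_eq_0[of 3 11]
      mangoldt_eq_0[of 3 13] mangoldt_eq_0[of 5 7])

lemma mangoldt_harm_0 [simp]: "mangoldt_harm 0 = 0"
  and mangoldt_harm_1 [simp]: "mangoldt_harm (Suc 0) = 0"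
  by (simp_all add: mangoldt_harm_def)

lemma mangoldt_harm_Suc: "mangoldt_harm (Suc n) = mangoldt_harm n + mangoldt (Suc n) / real (Suc n)"
  by (simp add: mangoldt_harm_def)

lemma mangoldt_harm_numeral:
  "mangoldt_harm (numeral k) = mangoldt_harm (pred_numeral k) + mangoldt (numeral k) / numeral k"
  using mangoldt_harm_Suc[of "pred_numeral k"] by (simp only: numeral_eq_Suc[symmetric] of_nat_numeral)

lemma mangoldt_harm_mono: "m \<le> n \<Longrightarrow> mangoldt_harm m \<le> mangoldt_harm n"
  unfolding mangoldt_harm_def by (intro sum_mono2) (auto intro!: divide_nonneg_nonneg mangoldt_nonneg)

text \<open>Measures logarithms in units of ln 2, so that each numerical bound becomes an inequality
  between natural numbers.\<close>

lemma ln_le_mult_ln2: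
  assumes "n ^ j \<le> 2 ^ i" "0 < n" "0 < j"
  shows "ln (real n) \<le> real i / real j * ln 2"
proof -
  have "real (n ^ j) \<le> real (2 ^ i)"
    using assms(1) by (simp only: of_nat_le_iff)
  then have "ln (real n ^ j) \<le> ln (2 ^ i)"
    using assms(2) by (subst ln_le_cancel_iff) auto
  then show ?thesis
    using assms by (simp add: ln_realpow field_simps)
qed

lemma ln_ge_mult_ln2:
  assumes "2 ^ i \<le> n ^ j" "0 < n" "0 < j"
  shows "real i / real j * ln 2 \<le> ln (real n)"
proof -
  have "real (2 ^ i) \<le> real (n ^ j)"
    using assms(1) by (simp only: of_nat_le_iff)
  then have "ln (2 ^ i) \<le> ln (real n ^ j)"
    using assms(2) by (subst ln_le_cancel_iff) auto
  then show ?thesis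
    using assms by (simp add: ln_realpow field_simps)
qed

text \<open>Both sides increase with n, so a single comparison of \<open>mangoldt_harm b\<close>
  with ln a, separated by i / j * ln 2, settles all n from a to b.\<close>

lemma mangoldt_harm_le_ln_block:
  assumes "mangoldt_harm b \<le> real i / real j * ln 2" "2 ^ i \<le> a ^ j" "0 < a" "0 < j"
    and "a \<le> n" "n \<le> b"
  shows "mangoldt_harm n \<le> ln (real n)"
proof -
  have "mangoldt_harm n \<le> mangoldt_harm b"
    by (intro mangoldt_harm_mono assms)
  also have "\<dots> \<le> ln (real a)"
    using assms(1) ln_ge_mult_ln2[OF assms(2-4)] by linarith
  also have "\<dots> \<le> ln (real n)"
    using assms by simp
  finally show ?thesis .
qed

lemma mangoldt_harm_le_ln_small:
  assumes "1 \<le> n" "n \<le> 46"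
  shows "mangoldt_harm n \<le> ln (real n)"
proof -
  \<comment> \<open>The fractions i / j come from p ^ j <= 2 ^ i, for example 3 ^ 5 = 243 <= 256 = 2
    ^ 8.\<close>
  have p: "ln (2::real) > 0"
    "ln 3 \<le> 8/5 * ln (2::real)" "ln 5 \<le> 7/3 * ln (2::real)" "ln 7 \<le> 17/6 * ln (2::real)"
    "ln 11 \<le> 7/2 * ln (2::real)" "ln 13 \<le> 15/4 * ln (2::real)" "ln 17 \<le> 25/6 * ln (2::real)"
    "ln 19 \<le> 17/4 * ln (2::real)" "ln 23 \<le> 23/5 * ln (2::real)" "ln 29 \<le> 5 * ln (2::real)"
    "ln 31 \<le> 5 * ln (2::real)" "ln 37 \<le> 21/4 * ln (2::real)" "ln 41 \<le> 27/5 * ln (2::real)"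
    "ln 43 \<le> 11/2 * ln (2::real)"
    using ln_le_mult_ln2[of 3 5 8] ln_le_mult_ln2[of 5 3 7] ln_le_mult_ln2[of 7 6 17]
      ln_le_mult_ln2[of 11 2 7] ln_le_mult_ln2[of 13 4 15] ln_le_mult_ln2[of 17 6 25]
      ln_le_mult_ln2[of 19 4 17] ln_le_mult_ln2[of 23 5 23] ln_le_mult_ln2[of 29 1 5]
      ln_le_mult_ln2[of 31 1 5] ln_le_mult_ln2[of 37 4 21] ln_le_mult_ln2[of 41 5 27]
      ln_le_mult_ln2[of 43 2 11]
    by simp_all
  note eval = mangoldt_harm_numeral mangoldt_small_primepow mangoldt_small_eq_0
  have H:
    "mangoldt_harm 2 \<le> ln 2"
    "mangoldt_harm 3 \<le> 3/2 * ln 2"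
    "mangoldt_harm 6 \<le> 2 * ln 2"
    "mangoldt_harm 7 \<le> 5/2 * ln 2"
    "mangoldt_harm 12 \<le> 3 * ln 2"
    "mangoldt_harm 15 \<le> 7/2 * ln 2"
    "mangoldt_harm 28 \<le> 4 * ln 2"
    "mangoldt_harm 31 \<le> 9/2 * ln 2"
    "mangoldt_harm 46 \<le> 5 * ln 2"
    by (simp_all add: eval) (use p in linarith)+
  consider "n = 1" | "n \<in> {2..2}" | "n \<in> {3..3}" | "n \<in> {4..6}" | "n \<in> {7..7}" | "n \<in> {8..12}"
    | "n \<in> {13..15}" | "n \<in> {16..28}" | "n \<in> {29..31}" | "n \<in> {32..46}"
    using assms unfolding atLeastAtMost_iff by linarith
  then show ?thesis
  proof cases
    case 2
    then show ?thesis
      using H(1) by (intro mangoldt_harm_le_ln_block[of 2 1 1 2]) simp_all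
  next
    case 3
    then show ?thesis
      using H(2) by (intro mangoldt_harm_le_ln_block[of 3 3 2 3]) simp_all
  next
    case 4
    then show ?thesis
      using H(3) by (intro mangoldt_harm_le_ln_block[of 6 2 1 4]) simp_all
  next
    case 5
    then show ?thesis
      using H(4) by (intro mangoldt_harm_le_ln_block[of 7 5 2 7]) simp_all
  next
    case 6
    then show ?thesis
      using H(5) by (intro mangoldt_harm_le_ln_block[of 12 3 1 8]) simp_all
  next
    case 7
    then show ?thesis
      using H(6) by (intro mangoldt_harm_le_ln_block[of 15 7 2 13]) simp_all
  next
    case 8
    then show ?thesis
      using H(7) by (intro mangoldt_harm_le_ln_block[of 28 4 1 16]) simp_all
  next
    case 9
    then show ?thesis
      using H(8) by (intro mangoldt_harm_le_ln_block[of 31 9 2 29]) simp_all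
  next
    case 10
    then show ?thesis
      using H(9) by (intro mangoldt_harm_le_ln_block[of 46 5 1 32]) simp_all
  qed simp
qed

lemma mangoldt_harm_le_ln: "1 \<le> n \<Longrightarrow> mangoldt_harm n \<le> ln (real n)"
  using mangoldt_harm_le_ln_small mangoldt_harm_le_ln_large by (cases "n \<le> 46") auto

text \<open>Partial summation replaces \<open>mangoldt q / q\<close> by the increments of ln q, and
  the sum then telescopes through (v - u) / v^2 <= 1 / u - 1 / v. As q = 1 contributes nothing, the
  telescoping starts at ln (2 * n) and not at ln n.\<close>

lemma sum_mangoldt_ln_sq_le:
  assumes "n \<ge> 2" "Q \<ge> 2"
  shows "(\<Sum>q=1..Q. mangoldt q / (real q * (ln (real (n * q)))\<^sup>2))
    \<le> ln 2 / (ln (real (n * 2)))\<^sup>2 + 1 / ln (real (n * 2))"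
proof -
  have ln_pos: "ln (real (n * q)) > 0" if "q \<ge> 1" for q
  proof -
    have "2 * 1 \<le> n * q"
      using assms(1) that by (intro mult_mono) auto
    then show ?thesis
      by (intro ln_gt_zero) linarith
  qed
  define b :: "nat \<Rightarrow> real" where
    "b = (\<lambda>q. if q = 1 then 0 else ln (real q) - ln (real (q - 1)))"
  have "(\<Sum>q=1..Q. mangoldt q / real q * (1 / (ln (real (n * q)))\<^sup>2))
      \<le> (\<Sum>q=1..Q. b q * (1 / (ln (real (n * q)))\<^sup>2))"
  proof (rule sum_mult_antimono_mono)
    fix k
    have "(\<Sum>q=1..k. b q) = ln (real k)" if "1 \<le> k"
      using that by (induction k rule: nat_induct_at_least) (auto simp: b_def)
    then show "(\<Sum>q=1..k. mangoldt q / real q) \<le> (\<Sum>q=1..k. b q)"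
      using mangoldt_harm_le_ln[of k] by (cases "k = 0") (auto simp: mangoldt_harm_def)
  next
    fix k :: nat assume k: "1 \<le> k"
    then have "ln (real (n * k)) \<le> ln (real (n * Suc k))"
      using assms(1) by (subst ln_le_cancel_iff) (auto simp del: of_nat_mult)
    then have "(ln (real (n * k)))\<^sup>2 \<le> (ln (real (n * Suc k)))\<^sup>2"
      using ln_pos[of k] k by (intro power_mono) auto
    then show "1 / (ln (real (n * Suc k)))\<^sup>2 \<le> 1 / (ln (real (n * k)))\<^sup>2"
      using ln_pos[of k] ln_pos[of "Suc k"] k
      by (intro divide_left_mono mult_pos_pos zero_less_power) auto
  qed simp
  also have "\<dots> \<le> ln 2 / (ln (real (n * 2)))\<^sup>2 + 1 / ln (real (n * 2)) - 1 / ln (real (n * Q))"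
    using assms(2)
  proof (induction Q rule: nat_induct_at_least)
    case base
    have "{1..2::nat} = {1, 2}"
      by auto
    then show ?case
      by (simp add: b_def)
  next
    case (Suc q)
    define u where "u = ln (real (n * q))"
    define v where "v = ln (real (n * Suc q))"
    have "u > 0" "v > 0"
      unfolding u_def v_def using Suc.hyps by (intro ln_pos; simp)+
    have "u \<le> v"
      unfolding u_def v_def using assms(1) Suc.hyps
      by (subst ln_le_cancel_iff) (auto simp del: of_nat_mult)
    have b: "b (Suc q) = v - u"
      using Suc.hyps assms(1) by (simp add: b_def u_def v_def ln_mult_pos del: of_nat_Suc mult_Suc_right)
    have "(v - u) * (1 / v\<^sup>2) \<le> 1 / u - 1 / v"
    proof -
      have "(v - u) * (1 / v\<^sup>2) \<le> (v - u) * (1 / (u * v))"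
        using \<open>u > 0\<close> \<open>v > 0\<close> \<open>u \<le> v\<close>
        by (intro mult_left_mono divide_left_mono) (auto simp: power2_eq_square)
      also have "\<dots> = 1 / u - 1 / v"
        using \<open>u > 0\<close> \<open>v > 0\<close> by (simp add: field_simps)
      finally show ?thesis .
    qed
    moreover have "(\<Sum>q=1..Suc q. b q * (1 / (ln (real (n * q)))\<^sup>2))
        = (\<Sum>q=1..q. b q * (1 / (ln (real (n * q)))\<^sup>2)) + (v - u) * (1 / v\<^sup>2)"
      unfolding b [symmetric] by (simp add: v_def del: of_nat_Suc mult_Suc_right)
    ultimately show ?case
      using Suc.IH unfolding u_def [symmetric] v_def [symmetric] by linarith
  qed
  also have "\<dots> \<le> ln 2 / (ln (real (n * 2)))\<^sup>2 + 1 / ln (real (n * 2))"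
    using ln_pos[of Q] assms(2) by simp
  finally show ?thesis
    by simp
qed

text \<open>Says that the gain (ln 2 / ln (2 * p))^2 is at least 1 / (4 * (p - 1)), the relative
  cost of the redirected mass at p. Equality holds at p = 2.\<close>

lemma ln_double_sq_le:
  assumes "p \<ge> (2::nat)"
  shows "(ln (real (p * 2)))\<^sup>2 \<le> 4 * (real p - 1) * (ln 2)\<^sup>2"
proof -
  \<comment> \<open>With this t, p / 2 is exactly the quadratic Taylor polynomial of
    \<open>exp\<close> at t - 1.\<close>
  define t where "t = sqrt (real p - 1)"
  have t: "1 \<le> t" "t\<^sup>2 = real p - 1"
    using assms by (auto simp: t_def)
  have "(1 + t\<^sup>2) / 2 = 1 + (t - 1) + (t - 1)\<^sup>2 / 2"
    by (simp add: power2_eq_square field_simps)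
  also have "\<dots> \<le> exp (t - 1)"
    using t by (intro exp_lower_Taylor_quadratic) auto
  finally have "ln ((1 + t\<^sup>2) / 2) \<le> t - 1"
    using ln_mono[of "(1 + t\<^sup>2) / 2" "exp (t - 1)"] by (auto simp: add_pos_nonneg)
  also have "\<dots> \<le> (t - 1) * (2 * ln 2)"
    using mult_left_mono[of 1 "2 * ln 2" "t - 1"] ln2_ge_two_thirds t by simp
  finally have "ln (real p / 2) \<le> (t - 1) * (2 * ln 2)"
    using t by simp
  moreover have "ln (real (p * 2)) = ln (real p / 2) + 2 * ln 2"
    using assms by (simp add: ln_div ln_mult_pos)
  ultimately have "ln (real (p * 2)) \<le> 2 * t * ln 2"
    by (simp add: algebra_simps)
  then have "(ln (real (p * 2)))\<^sup>2 \<le> (2 * t * ln 2)\<^sup>2"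
    using assms by (intro power_mono) auto
  then show ?thesis
    using t by (simp add: power_mult_distrib)
qed

lemma sum_inverse_power_sq_le:
  assumes "p \<ge> (2::nat)"
  shows "(\<Sum>k=2..N. 1 / (real p ^ k * (real k)\<^sup>2)) \<le> 1 / (4 * real p * (real p - 1))"
proof -
  have "(\<Sum>k=2..N. 1 / (real p ^ k * (real k)\<^sup>2)) \<le> (\<Sum>k=2..N. 1 / (real p ^ k * 4))"
  proof (intro sum_mono divide_left_mono mult_left_mono)
    fix k assume "k \<in> {2..N}"
    then show "4 \<le> (real k)\<^sup>2"
      using power_mono[of 2 "real k" 2] by simp
  qed (use assms in auto)
  also have "\<dots> = (\<Sum>k=2..N. 1 / real p ^ k) / 4"
    by (simp add: sum_divide_distrib)
  also have "(\<Sum>k=2..N. 1 / real p ^ k) \<le> 1 / (real p * (real p - 1))"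
  proof (cases "N \<ge> 1")
    case True
    then have "(\<Sum>k=2..N. 1 / real p ^ k) = 1 / (real p * (real p - 1)) - 1 / (real p ^ N * (real p - 1))"
    proof (induction N rule: nat_induct_at_least)
      case (Suc N)
      have "1 / (z * y) - 1 / (x * z * y) = 1 / (x * z)" if "x = y + 1" "y > 0" "z > 0" for x y z :: real
      proof -
        have "x > 0"
          using that by simp
        then have "1 / (z * y) - 1 / (x * z * y) = (x - 1) / (x * z * y)"
          by (simp add: diff_divide_distrib)
        also have "x - 1 = y"
          using that by simp
        also have "y / (x * z * y) = 1 / (x * z)"
          using \<open>y > 0\<close> by simp
        finally show ?thesis .
      qed
      from this[of "real p" "real p - 1" "real p ^ N"] show ?case
        using Suc assms by simp
    qed simp
    then show ?thesis
      using assms by simp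
  qed (use assms in simp)
  finally show ?thesis
    by (simp add: algebra_simps)
qed

subsection \<open>Descent to the primes\<close>

definition erdos_weight :: "nat \<Rightarrow> real" where
  "erdos_weight n = 1 / (real n * ln (real n))"

lemma erdos_weight_nonneg: "erdos_weight n \<ge> 0"
  by (cases "n = 0") (auto simp: erdos_weight_def)

text \<open>
  The first summand redistributes \<open>m\<close> along \<open>ln m = (\<Sum>d | d dvd m. mangoldt d)\<close>. For a proper prime
  power \<open>m = p ^ k\<close> this would send the share \<open>1 / k\<close> to 1; the second summand sends it to \<open>p\<close>
  instead.
\<close>

definition descent :: "nat \<Rightarrow> nat \<Rightarrow> real" where
  "descent m n = (if n dvd m then mangoldt (m div n) / ln (real m) else 0)
    + (if n = aprimedivisor m then mangoldt m / ln (real m) else 0)"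

lemma descent_nonneg: "descent m n \<ge> 0"
  by (cases "m = 0") (auto simp: descent_def mangoldt_nonneg intro!: add_nonneg_nonneg divide_nonneg_nonneg)

lemma descent_eq_0:
  assumes "\<not> n dvd m" "m > 1"
  shows "descent m n = 0"
  using assms by (auto simp: descent_def aprimedivisor_nat)

text \<open>Composite numbers pass on all their mass and primes keep it. Leaving out the divisor 1
  loses the share \<open>mangoldt m / ln m\<close>; the second summand of \<open>descent\<close>
  restores it, except that for prime m its target is m itself, outside the range.\<close>

lemma sum_descent:
  assumes "m > 1"
  shows "(\<Sum>n=2..<m. descent m n) = (if prime m then 0 else 1)"
proof -
  have fin: "finite {n. n dvd m}"
    using assms by simp
  have "(\<Sum>n | n dvd m. mangoldt (m div n)) = (\<Sum>d | d dvd m. mangoldt d :: real)"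
    using assms by (intro sum.reindex_bij_witness[of _ "\<lambda>d. m div d" "\<lambda>d. m div d"]) (auto elim!: dvdE)
  also have "\<dots> = ln (real m)"
    using assms by (simp add: mangoldt_sum)
  also have "{n. n dvd m} = insert 1 (insert m {n \<in> {2..<m}. n dvd m})"
    using assms by (auto dest: dvd_imp_le)
  finally have "(\<Sum>n\<in>{n \<in> {2..<m}. n dvd m}. mangoldt (m div n)) = ln (real m) - mangoldt m"
    using assms by simp
  moreover have "(\<Sum>n=2..<m. if n dvd m then mangoldt (m div n) / ln (real m) else 0)
      = (\<Sum>n\<in>{n \<in> {2..<m}. n dvd m}. mangoldt (m div n)) / ln (real m)"
    unfolding sum_divide_distrib by (rule sum.inter_filter [symmetric]) simp
  ultimately have proper: "(\<Sum>n=2..<m. if n dvd m then mangoldt (m div n) / ln (real m) else 0)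
      = (ln (real m) - mangoldt m) / ln (real m)"
    by simp
  have extra: "(\<Sum>n=2..<m. if n = aprimedivisor m then mangoldt m / ln (real m) else 0)
      = (if prime m then 0 else mangoldt m / ln (real m))"
  proof -
    have "aprimedivisor m \<in> {2..<m} \<longleftrightarrow> \<not> prime m"
      using assms aprimedivisor_nat[of m] aprimedivisor_le_nat[of m] aprimedivisor_gt_Suc_0[of m]
      by (cases "aprimedivisor m = m") (auto simp: prime_ge_2_nat)
    then show ?thesis
      by simp
  qed
  show ?thesis
    unfolding descent_def sum.distrib proper extra
    using assms by (auto simp: diff_divide_distrib)
qed

section \<open>Superharmonicity of the weight\<close>

lemma sum_erdos_weight_descent_dvd_le:
  assumes "n \<ge> 2"
  shows "(\<Sum>m\<in>{n<..N}. erdos_weight m * (if n dvd m then mangoldt (m div n) / ln (real m) else 0))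
    \<le> 1 / real n * (ln 2 / (ln (real (n * 2)))\<^sup>2 + 1 / ln (real (n * 2)))"
proof -
  define f :: "nat \<Rightarrow> real" where "f = (\<lambda>m. erdos_weight m * (mangoldt (m div n) / ln (real m)))"
  \<comment> \<open>The estimate for the sum over q requires an upper end of at least 2; the
    additional terms are nonnegative.\<close>
  define Q where "Q = max N 2"
  have f_nonneg: "f m \<ge> 0" for m
    by (cases "m = 0") (auto simp: f_def erdos_weight_nonneg mangoldt_nonneg)
  have "(\<Sum>m\<in>{n<..N}. erdos_weight m * (if n dvd m then mangoldt (m div n) / ln (real m) else 0))
      = (\<Sum>m\<in>{m \<in> {n<..N}. n dvd m}. f m)"
    by (subst sum.inter_filter) (auto intro!: sum.cong simp: f_def)
  also have "\<dots> \<le> sum f ((\<lambda>q. n * q) ` {1..Q})"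
  proof (rule sum_mono2)
    show "{m \<in> {n<..N}. n dvd m} \<subseteq> (\<lambda>q. n * q) ` {1..Q}"
    proof
      fix m assume m: "m \<in> {m \<in> {n<..N}. n dvd m}"
      then obtain q where q: "m = n * q"
        by auto
      with m have "0 < q" "q \<le> N"
        using assms by (auto intro: Nat.gr0I order.trans[of q "n * q" N])
      then show "m \<in> (\<lambda>q. n * q) ` {1..Q}"
        using q by (auto simp: Q_def)
    qed
  qed (auto simp: f_nonneg)
  also have "\<dots> = (\<Sum>q=1..Q. f (n * q))"
    using assms by (subst sum.reindex) (auto simp: inj_on_def)
  also have "\<dots> = 1 / real n * (\<Sum>q=1..Q. mangoldt q / (real q * (ln (real (n * q)))\<^sup>2))"
    unfolding sum_distrib_left using assms
    by (intro sum.cong) (auto simp: f_def erdos_weight_def power2_eq_square)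
  also have "\<dots> \<le> 1 / real n * (ln 2 / (ln (real (n * 2)))\<^sup>2 + 1 / ln (real (n * 2)))"
    using assms by (intro mult_left_mono sum_mangoldt_ln_sq_le) (auto simp: Q_def)
  finally show ?thesis .
qed

text \<open>\<open>mangoldt\<close> vanishes off prime powers, so only m = p ^ k with k >= 2
  contributes, namely 1 / (p ^ k * k^2 * ln p).\<close>

lemma sum_erdos_weight_descent_aprimedivisor_le:
  assumes "prime p"
  shows "(\<Sum>m\<in>{p<..N}. erdos_weight m * (if p = aprimedivisor m then mangoldt m / ln (real m) else 0))
    \<le> 1 / (4 * real p * (real p - 1)) / ln (real p)"
proof -
  have p: "p \<ge> 2"
    using assms by (rule prime_ge_2_nat)
  define f :: "nat \<Rightarrow> real" where
    "f = (\<lambda>m. erdos_weight m * (if p = aprimedivisor m then mangoldt m / ln (real m) else 0))"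
  have f_nonneg: "f m \<ge> 0" for m
    by (cases "m = 0") (auto simp: f_def erdos_weight_nonneg mangoldt_nonneg)
  have "(\<Sum>m\<in>{p<..N}. f m) = (\<Sum>m\<in>{m \<in> {p<..N}. f m \<noteq> 0}. f m)"
    by (intro sum.mono_neutral_right) auto
  also have "\<dots> \<le> sum f ((\<lambda>k. p ^ k) ` {2..N})"
  proof (rule sum_mono2)
    show "{m \<in> {p<..N}. f m \<noteq> 0} \<subseteq> (\<lambda>k. p ^ k) ` {2..N}"
    proof
      fix m assume m: "m \<in> {m \<in> {p<..N}. f m \<noteq> 0}"
      then have "p = aprimedivisor m" "primepow m"
        by (auto simp: f_def mangoldt_def split: if_splits)
      then obtain k where k: "m = p ^ k"
        by (metis primepow_decompose)
      have "k \<noteq> 0" "k \<noteq> 1"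
        using m k p by (auto intro!: Nat.gr0I)
      moreover have "k \<le> N"
        using m k power_gt_expt[of p k] p by auto
      ultimately show "m \<in> (\<lambda>k. p ^ k) ` {2..N}"
        using k by auto
    qed
  qed (auto simp: f_nonneg)
  also have "\<dots> = (\<Sum>k=2..N. f (p ^ k))"
    using p by (subst sum.reindex) (auto simp: inj_on_def)
  also have "\<dots> = (\<Sum>k=2..N. 1 / (real p ^ k * (real k)\<^sup>2)) / ln (real p)"
    unfolding sum_divide_distrib using assms p
    by (intro sum.cong)
      (auto simp: f_def erdos_weight_def aprimedivisor_prime_power ln_realpow power2_eq_square)
  also have "\<dots> \<le> 1 / (4 * real p * (real p - 1)) / ln (real p)"
    using p by (intro divide_right_mono sum_inverse_power_sq_le) auto
  finally show ?thesis
    by (simp add: f_def)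
qed

lemma sum_erdos_weight_descent_le:
  assumes "n \<ge> 2"
  shows "(\<Sum>m\<in>{n<..N}. erdos_weight m * descent m n) \<le> erdos_weight n"
proof -
  define l :: real where "l = ln 2"
  define L where "L = ln (real n)"
  have pos: "l > 0" "L > 0" "L + l > 0"
    using assms by (auto simp: l_def L_def add_pos_pos)
  have ln2n: "ln (real (n * 2)) = L + l"
    using assms by (simp add: L_def l_def ln_mult_pos)
  \<comment> \<open>The left side is (L + 2 * l) / (L + l)^2, and L * (L + 2 * l) = (L + l)^2 - l^2;
    the subtracted term is the room left for redirected mass.\<close>
  have gap: "l / (L + l)\<^sup>2 + 1 / (L + l) = 1 / L - l\<^sup>2 / (L * (L + l)\<^sup>2)"
  proof -
    have "1 / (L + l) = (L + l) / (L + l)\<^sup>2"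
      using pos by (simp add: power2_eq_square)
    then have "l / (L + l)\<^sup>2 + 1 / (L + l) = (l + (L + l)) / (L + l)\<^sup>2"
      by (simp only: add_divide_distrib)
    also have "\<dots> = L * (l + (L + l)) / (L * (L + l)\<^sup>2)"
      using pos by simp
    also have "L * (l + (L + l)) = (L + l)\<^sup>2 - l\<^sup>2"
      by (simp add: power2_eq_square algebra_simps)
    also have "\<dots> / (L * (L + l)\<^sup>2) = 1 / L - l\<^sup>2 / (L * (L + l)\<^sup>2)"
      using pos by (simp add: diff_divide_distrib)
    finally show ?thesis .
  qed
  have "(\<Sum>m\<in>{n<..N}. erdos_weight m * (if n = aprimedivisor m then mangoldt m / ln (real m) else 0))
      \<le> 1 / real n * (l\<^sup>2 / (L * (L + l)\<^sup>2))"
  proof (cases "prime n")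
    case True
    have "(L + l)\<^sup>2 \<le> 4 * (real n - 1) * l\<^sup>2"
      using ln_double_sq_le[OF assms] by (simp only: ln2n l_def)
    then have "1 / (4 * (real n - 1)) \<le> l\<^sup>2 / (L + l)\<^sup>2"
      using assms pos by (simp add: field_simps)
    then have "1 / (4 * (real n - 1)) / (real n * L) \<le> l\<^sup>2 / (L + l)\<^sup>2 / (real n * L)"
      using pos by (intro divide_right_mono) auto
    then show ?thesis
      using sum_erdos_weight_descent_aprimedivisor_le[OF True, of N]
      by (simp add: L_def [symmetric] mult_ac)
  next
    case False
    have "n \<noteq> aprimedivisor m" if "m > n" for m
      using that assms False by (auto simp: aprimedivisor_nat)
    then have "(\<Sum>m\<in>{n<..N}. erdos_weight m * (if n = aprimedivisor m then mangoldt m / ln (real m) else 0)) = 0"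
      by (intro sum.neutral) auto
    then show ?thesis
      using pos by simp
  qed
  moreover have "(\<Sum>m\<in>{n<..N}. erdos_weight m * (if n dvd m then mangoldt (m div n) / ln (real m) else 0))
      \<le> 1 / real n * (1 / L - l\<^sup>2 / (L * (L + l)\<^sup>2))"
    using sum_erdos_weight_descent_dvd_le[OF assms, of N] by (simp only: ln2n gap l_def [symmetric])
  ultimately have "(\<Sum>m\<in>{n<..N}. erdos_weight m * descent m n)
      \<le> 1 / real n * (1 / L - l\<^sup>2 / (L * (L + l)\<^sup>2)) + 1 / real n * (l\<^sup>2 / (L * (L + l)\<^sup>2))"
    by (simp add: descent_def distrib_left sum.distrib)
  also have "\<dots> = erdos_weight n"
    by (simp add: erdos_weight_def L_def algebra_simps)
  finally show ?thesis .
qed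

text \<open>
  The total amount of mass that passes through \<open>n\<close> when the source mass \<open>s\<close> on \<open>{..N}\<close> is moved down
  along the kernel \<open>K\<close>.
\<close>

function flow :: "(nat \<Rightarrow> real) \<Rightarrow> (nat \<Rightarrow> nat \<Rightarrow> real) \<Rightarrow> nat \<Rightarrow> nat \<Rightarrow> real" where
  "flow s K N n = s n + (\<Sum>m\<in>{n<..N}. flow s K N m * K m n)"
  by auto
termination by (relation "Wellfounded.measure (\<lambda>(s, K, N, n). N - n)") auto

declare flow.simps [simp del]

text \<open>Conservation of mass: the recursion is summed over n and the inflow is regrouped by the
  sender m.\<close>

lemma sum_flow:
  "(\<Sum>n=a..N. flow s K N n) = (\<Sum>n=a..N. s n) + (\<Sum>m=a..N. flow s K N m * (\<Sum>n=a..<m. K m n))"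
proof -
  have "(\<Sum>n=a..N. flow s K N n) = (\<Sum>n=a..N. s n) + (\<Sum>n=a..N. \<Sum>m\<in>{n<..N}. flow s K N m * K m n)"
    by (subst flow.simps) (simp add: sum.distrib)
  also have "(\<Sum>n=a..N. \<Sum>m\<in>{n<..N}. flow s K N m * K m n)
      = (\<Sum>m=a..N. \<Sum>n=a..<m. flow s K N m * K m n)"
    unfolding sum.Sigma [OF finite_atLeastAtMost ballI, OF finite_greaterThanAtMost]
      sum.Sigma [OF finite_atLeastAtMost ballI, OF finite_atLeastLessThan]
    by (intro sum.reindex_bij_witness[of _ "\<lambda>(m, n). (n, m)" "\<lambda>(n, m). (m, n)"]) auto
  finally show ?thesis
    by (simp add: sum_distrib_left)
qed

text \<open>Mass moves only to divisors, so mass found at n can be traced up to a source that is a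
  multiple of n.\<close>

lemma flow_support:
  assumes "\<And>m n. 0 < n \<Longrightarrow> n < m \<Longrightarrow> K m n \<noteq> 0 \<Longrightarrow> n dvd m"
    and "flow s K N n \<noteq> 0" "0 < n"
  shows "\<exists>a. s a \<noteq> 0 \<and> n dvd a"
  using assms(2,3)
proof (induction "N - n" arbitrary: n rule: less_induct)
  case less
  show ?case
  proof (cases "s n = 0")
    case True
    then have "(\<Sum>m\<in>{n<..N}. flow s K N m * K m n) \<noteq> 0"
      using less.prems(1) by (subst (asm) flow.simps) simp
    then obtain m where m: "m \<in> {n<..N}" "flow s K N m * K m n \<noteq> 0"
      by (meson sum.neutral)
    then have "n dvd m"
      using assms(1)[of n m] less.prems(2) by auto
    moreover have "\<exists>a. s a \<noteq> 0 \<and> m dvd a"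
      using m by (intro less.hyps) auto
    ultimately show ?thesis
      using dvd_trans by blast
  qed auto
qed

text \<open>Descending induction on n. Off the sources, the bounds above n combine with
  superharmonicity of w; at a source nothing arrives, and this is where the antichain condition
  enters.\<close>

lemma flow_le:
  assumes "\<And>a b. s a \<noteq> 0 \<Longrightarrow> s b \<noteq> 0 \<Longrightarrow> a dvd b \<Longrightarrow> a = b"
    and "\<And>n. s n \<noteq> 0 \<Longrightarrow> 0 < n \<and> s n \<le> w n"
    and "\<And>m n. 0 \<le> K m n"
    and "\<And>m n. 0 < n \<Longrightarrow> n < m \<Longrightarrow> K m n \<noteq> 0 \<Longrightarrow> n dvd m"
    and "\<And>n. n \<ge> 2 \<Longrightarrow> (\<Sum>m\<in>{n<..N}. w m * K m n) \<le> w n"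
    and "n \<ge> 2"
  shows "flow s K N n \<le> w n"
  using assms(6)
proof (induction "N - n" arbitrary: n rule: less_induct)
  case less
  show ?case
  proof (cases "s n = 0")
    case True
    then have "flow s K N n = (\<Sum>m\<in>{n<..N}. flow s K N m * K m n)"
      by (subst flow.simps) simp
    also have "\<dots> \<le> (\<Sum>m\<in>{n<..N}. w m * K m n)"
      using less by (intro sum_mono mult_right_mono assms(3) less.hyps) auto
    also have "\<dots> \<le> w n"
      using less.prems by (rule assms(5))
    finally show ?thesis .
  next
    case False
    \<comment> \<open>Mass arriving at \<open>n\<close> would come from a proper multiple of \<open>n\<close> in the support of \<open>s\<close>.\<close>
    have "flow s K N m * K m n = 0" if "m \<in> {n<..N}" for m
    proof (rule ccontr)
      assume "flow s K N m * K m n \<noteq> 0"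
      then have "n dvd m" and "\<exists>a. s a \<noteq> 0 \<and> m dvd a"
        using flow_support[of K s N m] assms(4) that less.prems by auto
      then obtain a where "s a \<noteq> 0" "m dvd a"
        by blast
      moreover have "n = a"
        using \<open>n dvd m\<close> \<open>m dvd a\<close> \<open>s a \<noteq> 0\<close> False by (intro assms(1)) (auto intro: dvd_trans)
      ultimately show False
        using that less.prems by (auto dest: dvd_imp_le)
    qed
    then have "(\<Sum>m\<in>{n<..N}. flow s K N m * K m n) = 0"
      by (intro sum.neutral ballI)
    then have "flow s K N n = s n"
      by (subst flow.simps) simp
    then show ?thesis
      using assms(2)[OF False] by simp
  qed
qed

section \<open>Finite primitive sets and passage to the supremum\<close>

lemma sum_primitive_le:
  assumes "primitive A" "A \<subseteq> {..N}"
  shows "(\<Sum>a\<in>A. erdos_weight a) \<le> (\<Sum>p | prime p \<and> p \<le> N. erdos_weight p)"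
proof -
  define s where "s = (\<lambda>a. if a \<in> A then erdos_weight a else 0)"
  define y where "y = flow s descent N"
  have A: "A \<subseteq> {2..N}"
    using assms by (auto simp: primitive_def)
  have y_le: "y n \<le> erdos_weight n" if "n \<ge> 2" for n
    unfolding y_def
  proof (rule flow_le)
    show "a = b" if "s a \<noteq> 0" "s b \<noteq> 0" "a dvd b" for a b
      using that assms(1) by (auto simp: s_def primitive_def split: if_splits)
    show "0 < n \<and> s n \<le> erdos_weight n" if "s n \<noteq> 0" for n
      using that A by (auto simp: s_def split: if_splits)
    show "n dvd m" if "0 < n" "n < m" "descent m n \<noteq> 0" for m n
      using that descent_eq_0[of n m] by linarith
  qed (auto simp: descent_nonneg that sum_erdos_weight_descent_le)
  \<comment> \<open>In the balance over {2..N} the mass at composite numbers cancels, so the total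
    source equals the mass on primes.\<close>
  have "(\<Sum>n=2..N. y n) = (\<Sum>n=2..N. s n) + (\<Sum>m=2..N. y m * (\<Sum>n=2..<m. descent m n))"
    unfolding y_def by (rule sum_flow)
  also have "(\<Sum>n=2..N. s n) = (\<Sum>a\<in>A. erdos_weight a)"
    using A by (intro sum.mono_neutral_cong_right) (auto simp: s_def)
  also have "(\<Sum>m=2..N. y m * (\<Sum>n=2..<m. descent m n)) = (\<Sum>m=2..N. if prime m then 0 else y m)"
    by (intro sum.cong) (auto simp: sum_descent)
  finally have "(\<Sum>a\<in>A. erdos_weight a) = (\<Sum>n=2..N. y n - (if prime n then 0 else y n))"
    by (simp add: sum_subtractf)
  also have "\<dots> = (\<Sum>p | prime p \<and> p \<le> N. y p)"
    by (intro sum.mono_neutral_cong_right) (auto simp: prime_ge_2_nat)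
  also have "\<dots> \<le> (\<Sum>p | prime p \<and> p \<le> N. erdos_weight p)"
    by (intro sum_mono y_le) (auto simp: prime_ge_2_nat)
  finally show ?thesis .
qed

lemma primitive_subset: "primitive A \<Longrightarrow> B \<subseteq> A \<Longrightarrow> primitive B"
  by (auto simp: primitive_def)

theorem theorem1p2:
  fixes A :: "nat set"
  assumes "primitive A"
  shows "erdos_f A \<le> erdos_f {p. prime p}"
proof -
  let ?w = "\<lambda>a::nat. ennreal (erdos_weight a)"
  \<comment> \<open>In \<open>ennreal\<close> the infinite sum is the supremum of its finite partial
    sums, so finite subsets of A suffice and convergence is no issue.\<close>
  have f_eq: "erdos_f B = (SUP F\<in>{F. finite F \<and> F \<subseteq> B}. sum ?w F)" for B
    unfolding erdos_f_def erdos_weight_def [symmetric]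
    by (intro infsumI nonneg_has_sum_complete) simp
  show ?thesis
    unfolding f_eq[of A]
  proof (rule SUP_least)
    fix F assume "F \<in> {F. finite F \<and> F \<subseteq> A}"
    then have F: "finite F" "primitive F"
      using assms primitive_subset by auto
    then obtain N where N: "F \<subseteq> {..N}"
      by (meson finite_nat_iff_bounded_le)
    have "sum ?w F = ennreal (\<Sum>a\<in>F. erdos_weight a)"
      by (simp add: sum_ennreal erdos_weight_nonneg)
    also have "\<dots> \<le> ennreal (\<Sum>p | prime p \<and> p \<le> N. erdos_weight p)"
      by (intro ennreal_leI sum_primitive_le F N)
    also have "\<dots> = (\<Sum>p | prime p \<and> p \<le> N. ?w p)"
      by (simp add: sum_ennreal erdos_weight_nonneg)
    also have "\<dots> \<le> erdos_f {p. prime p}"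
      unfolding f_eq by (rule SUP_upper) auto
    finally show "sum ?w F \<le> erdos_f {p. prime p}" .
  qed
qed

end
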